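(* Let $f\in\mathcal{R}$, $f(z)=z+\sum_{k=2}^\infty a_kz^k$, and let $m,n\ge2$ be integers. Then $$\left|\frac{mn}{2(m+n-1)}a_ma_n-a_{m+n-1}\right|+\frac{mn|a_ma_n|}{2(m+n-1)}\le\frac{2}{m+n-1}.$$ This is equivalent to $$|\lambda a_ma_n-a_{m+n-1}|\le\frac{2}{m+n-1}\max\left\{1,\left|1-2\lambda\frac{m+n-1}{mn}\right|\right\}\quad\text{for all }\lambda\in\mathbb{C}.$$ Equality holds in both inequalities for the function $$f(z)=2\log\frac{1}{1-z}-z$$ when $\left|1-2\lambda\frac{m+n-1}{mn}\right|\ge1$, and for the function $$f(z)=\int_{[0,z]}\frac{1+\zeta^{m+n-2}}{1-\zeta^{m+n-2}}\,d\zeta$$ (integration over the segment from $0$ to $z$) when $\left|1-2\lambda\frac{m+n-1}{mn}\right|<1$.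
   Context: $\mathbb{D}$ is the open unit disk in $\mathbb{C}$. The (normalized) Noshiro-Warschawski class $\mathcal{R}$ is the set of all functions $f$ analytic in $\mathbb{D}$ with $\mathrm{Re}\,f'(z)>0$ for all $z\in\mathbb{D}$, $f(0)=0$ and $f'(0)=1$. The branch of the logarithm is chosen so that $\log 1=0$. *)

theory Defs
  imports "HOL-Complex_Analysis.Complex_Analysis"
begin

definition noshiro_warschawski :: "(complex \<Rightarrow> complex) set" where
  "noshiro_warschawski =
    {f. f holomorphic_on ball 0 1 \<and> (\<forall>z\<in>ball 0 1. Re (deriv f z) > 0) \<and> f 0 = 0 \<and> deriv f 0 = 1}"

definition taylor_coeff :: "(complex \<Rightarrow> complex) \<Rightarrow> nat \<Rightarrow> complex" where
  "taylor_coeff f k = fps_nth (fps_expansion f 0) k"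

definition coeff_sum :: "nat \<Rightarrow> nat \<Rightarrow> (nat \<Rightarrow> complex) \<Rightarrow> real" where
  "coeff_sum m n a =
     cmod (of_nat (m * n) / (2 * of_nat (m + n - 1)) * a m * a n - a (m + n - 1))
     + real (m * n) * cmod (a m * a n) / (2 * real (m + n - 1))"

definition zalcman_functional :: "complex \<Rightarrow> nat \<Rightarrow> nat \<Rightarrow> (nat \<Rightarrow> complex) \<Rightarrow> real" where
  "zalcman_functional \<mu> m n a = cmod (\<mu> * a m * a n - a (m + n - 1))"

definition param_modulus :: "complex \<Rightarrow> nat \<Rightarrow> nat \<Rightarrow> real" where
  "param_modulus \<mu> m n = cmod (1 - 2 * \<mu> * (of_nat (m + n - 1) / of_nat (m * n)))"

text \<open>On the unit disk \<open>1 / (1 - z)\<close> has positive real part, so the principal branch \<open>Ln\<close>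
  is there the analytic branch with \<open>log 1 = 0\<close>.\<close>

definition log_extremal :: "complex \<Rightarrow> complex" where
  "log_extremal z = 2 * Ln (1 / (1 - z)) - z"

definition integral_extremal :: "nat \<Rightarrow> nat \<Rightarrow> complex \<Rightarrow> complex" where
  "integral_extremal m n z =
     contour_integral (linepath 0 z) (\<lambda>\<zeta>. (1 + \<zeta> ^ (m + n - 2)) / (1 - \<zeta> ^ (m + n - 2)))"

end

theory Submission
  imports Defs
begin

text \<open>The numbers \<open>c\<^sub>k = (k + 1) a\<^sub>k\<^sub>+\<^sub>1\<close> are the Taylor coefficients of \<open>f'\<close>, and for
  \<open>r < 1\<close> the weight \<open>w = Re f'(r u)\<close> is a probability density on the circle \<open>\<bar>u\<bar> = 1\<close>
  with moments \<open>M\<^sub>k = \<integral> u\<^sup>k w = cnj (c\<^sub>k r\<^sup>k) / 2\<close> for \<open>k > 0\<close>. Hence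
  \<open>M\<^sub>j\<^sub>+\<^sub>k - b M\<^sub>j = \<integral> u\<^sup>j (u\<^sup>k - b) w\<close>, which has modulus at most
  \<open>\<integral> (1 + \<bar>u\<^sup>k - b\<bar>\<^sup>2) w / 2\<close>. For \<open>b = 2 cnj \<mu> M\<^sub>k\<close> this equals
  \<open>1 + (\<bar>1 - 2\<mu>\<bar>\<^sup>2 - 1) \<bar>M\<^sub>k\<bar>\<^sup>2 / 2\<close>, that is, \<open>1\<close> when \<open>\<bar>1 - 2\<mu>\<bar> = 1\<close>. Letting
  \<open>r\<close> tend to \<open>1\<close> and choosing the unimodular \<open>1 - 2\<mu>\<close> so that
  the two terms of the functional align gives the sharp bound; scaling
  \<open>1 - 2\<mu>\<close> freely gives the equivalence of the two inequalities. Both extremal functions satisfy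
  \<open>f'(z) = (1 + z\<^sup>d) / (1 - z\<^sup>d)\<close>, with \<open>d = 1\<close> and \<open>d = m + n - 2\<close>.\<close>

section \<open>Moments of the real part on circles of radius below 1\<close>

lemma has_integral_circle_power_quotient:
  fixes h :: "complex \<Rightarrow> complex"
  assumes h: "h holomorphic_on ball 0 1" and r: "0 < r" "r < 1"
  shows "((\<lambda>t. h (of_real r * cis (2 * pi * t)) / (of_real r * cis (2 * pi * t)) ^ k)
          has_integral (deriv ^^ k) h 0 / fact k) {0..1}"
proof -
  have sub: "cball 0 r \<subseteq> ball (0::complex) 1" and sub': "ball 0 r \<subseteq> ball (0::complex) 1"
    using r by auto
  have "((\<lambda>u. h u / (u - 0) ^ Suc k) has_contour_integral
          (2 * pi * \<i>) / fact k * (deriv ^^ k) h 0) (circlepath 0 r)"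
    using r holomorphic_on_subset[OF h sub] holomorphic_on_subset[OF h sub']
    by (intro Cauchy_has_contour_integral_higher_derivative_circlepath)
       (auto intro: holomorphic_on_imp_continuous_on)
  \<comment> \<open>The velocity of the circle path is 2 pi i times the point itself, which cancels
    one of the \<open>Suc k\<close> factors of the denominator.\<close>
  moreover have "h (circlepath 0 r t) / (circlepath 0 r t - 0) ^ Suc k *
      vector_derivative (circlepath 0 r) (at t) =
      (2 * pi * \<i>) * (h (r * cis (2 * pi * t)) / (r * cis (2 * pi * t)) ^ k)" for t
  proof -
    have "circlepath 0 r t = r * cis (2 * pi * t)"
      by (simp add: circlepath cis_conv_exp mult_ac)
    moreover have "vector_derivative (circlepath 0 r) (at t) = 2 * pi * \<i> * (r * cis (2 * pi * t))"
      by (simp add: vector_derivative_circlepath cis_conv_exp mult_ac)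
    ultimately show ?thesis
      using r by simp
  qed
  ultimately have "((\<lambda>t. (2 * pi * \<i>) * (h (r * cis (2 * pi * t)) / (r * cis (2 * pi * t)) ^ k))
      has_integral (2 * pi * \<i>) / fact k * (deriv ^^ k) h 0) {0..1}"
    by (simp only: has_contour_integral)
  from has_integral_mult_right[OF this, of "1 / (2 * pi * \<i>)"] show ?thesis
    by simp
qed

text \<open>Write Re p = (p + cnj p) / 2. The analytic half has mean 0 against \<open>u ^ k\<close>;
  the other half is the conjugate of the Cauchy formula for the k-th coefficient, since cnj u = 1 /
  u.\<close>

lemma circle_moment_Re:
  fixes p :: "complex \<Rightarrow> complex"
  assumes p: "p holomorphic_on ball 0 1" and r: "0 < r" "r < 1" and k: "k > 0"
  shows "((\<lambda>t. cis (2 * pi * t) ^ k * of_real (Re (p (of_real r * cis (2 * pi * t)))))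
          has_integral cnj ((deriv ^^ k) p 0 / fact k * of_real r ^ k) / 2) {0..1}"
proof -
  define u where "u t = cis (2 * pi * t)" for t
  have u: "u t \<noteq> 0" "cnj (u t) = inverse (u t)" for t
    unfolding u_def by (simp_all add: cis_cnj cis_inverse)
  \<comment> \<open>Exponent 0 gives the mean value property, applied to a function that vanishes at
    0 because k > 0.\<close>
  have "((\<lambda>t. (\<lambda>z. z ^ k * p z) (of_real r * u t) / (of_real r * u t) ^ 0)
          has_integral (deriv ^^ 0) (\<lambda>z. z ^ k * p z) 0 / fact 0) {0..1}"
    unfolding u_def using r p
    by (intro has_integral_circle_power_quotient) (auto intro!: holomorphic_intros)
  then have "((\<lambda>t. of_real r ^ k * (u t ^ k * p (of_real r * u t))) has_integral 0) {0..1}"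
    using k by (simp add: power_mult_distrib mult_ac zero_power)
  from has_integral_mult_right[OF this, of "1 / of_real r ^ k"]
  have pos: "((\<lambda>t. u t ^ k * p (of_real r * u t)) has_integral 0) {0..1}"
    using r by simp
  have "((\<lambda>t. p (of_real r * u t) / (of_real r * u t) ^ k)
          has_integral (deriv ^^ k) p 0 / fact k) {0..1}"
    unfolding u_def by (intro has_integral_circle_power_quotient assms)
  from has_integral_mult_right[OF this, of "of_real r ^ k"]
  have "((\<lambda>t. p (of_real r * u t) / u t ^ k)
          has_integral of_real r ^ k * ((deriv ^^ k) p 0 / fact k)) {0..1}"
    using r by (simp add: power_mult_distrib)
  then have neg: "((\<lambda>t. u t ^ k * cnj (p (of_real r * u t)))
          has_integral cnj (of_real r ^ k * ((deriv ^^ k) p 0 / fact k))) {0..1}"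
    by (subst has_integral_cnj[symmetric]) (simp add: o_def u power_inverse field_simps)
  have eq: "w * of_real (Re z) = (w * z + w * cnj z) * (1 / 2)" for w z
    using complex_add_cnj[of z] by (simp flip: distrib_left)
  have "((\<lambda>t. u t ^ k * of_real (Re (p (of_real r * u t))))
        has_integral (0 + cnj (of_real r ^ k * ((deriv ^^ k) p 0 / fact k))) * (1 / 2)) {0..1}"
    unfolding eq by (intro has_integral_mult_left has_integral_add pos neg)
  then show ?thesis
    by (simp add: u_def mult_ac)
qed

section \<open>Coefficient bound for functions with positive real part\<close>

lemma caratheodory_disk_bound:
  fixes p :: "complex \<Rightarrow> complex"
  assumes p: "p holomorphic_on ball 0 1" and Re: "\<And>z. z \<in> ball 0 1 \<Longrightarrow> Re (p z) > 0"
    and p0: "p 0 = 1" and jk: "j > 0" "k > 0" and r: "0 < r" "r < 1"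
    and \<mu>: "cmod (1 - 2 * \<mu>) = 1"
  defines "c \<equiv> \<lambda>l. (deriv ^^ l) p 0 / fact l"
  shows "cmod (\<mu> * c j * c k - c (j + k)) * r ^ (j + k) \<le> 2"
proof -
  define u where "u t = cis (2 * pi * t)" for t
  define w where "w t = Re (p (of_real r * u t))" for t
  define M where "M l = cnj (c l * of_real r ^ l) / 2" for l
  \<comment> \<open>The moments are conjugated and halved. With this \<open>b\<close>,
    \<open>M (j + k) - b * M j\<close> is half the conjugate of
    \<open>(c (j + k) - \<mu> * c j * c k) * r ^ (j + k)\<close>.\<close>
  define b where "b = 2 * cnj \<mu> * M k"
  have w: "w t > 0" for t
    unfolding w_def u_def using r by (intro Re) (simp add: norm_mult)
  have mom: "((\<lambda>t. u t ^ l * of_real (w t)) has_integral M l) {0..1}" if "l > 0" for l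
    unfolding u_def w_def M_def c_def by (intro circle_moment_Re p r that)
  have "((\<lambda>t. p (of_real r * u t) / (of_real r * u t) ^ 0)
          has_integral (deriv ^^ 0) p 0 / fact 0) {0..1}"
    unfolding u_def by (rule has_integral_circle_power_quotient[OF p r])
  from has_integral_Re[OF this] have w1: "(w has_integral 1) {0..1}"
    using p0 by (simp add: w_def [abs_def])
  have I1: "((\<lambda>t. u t ^ (j + k) * of_real (w t) - b * (u t ^ j * of_real (w t)))
              has_integral (M (j + k) - b * M j)) {0..1}"
    using jk by (intro has_integral_diff has_integral_mult_right mom) auto
  \<comment> \<open>This integrand is \<open>w t\<close> times (1 + |u^k - b|^2) / 2, expanded so
    that only the total mass and the k-th moment enter.\<close>
  have "((\<lambda>t. w t * ((2 + (cmod b)\<^sup>2) / 2) - Re (cnj b * (u t ^ k * of_real (w t))))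
              has_integral (1 * ((2 + (cmod b)\<^sup>2) / 2) - Re (cnj b * M k))) {0..1}"
    using jk by (intro has_integral_diff has_integral_mult_left has_integral_Re has_integral_mult_right mom w1) auto
  moreover have "1 * ((2 + (cmod b)\<^sup>2) / 2) - Re (cnj b * M k) = 1"
  proof -
    \<comment> \<open>On the circle |1 - 2 \<mu>| = 1 one has |\<mu>|^2 = Re \<mu>, so |b|^2 / 2
      cancels against \<open>Re (cnj b * M k)\<close>.\<close>
    have "(cmod (1 - 2 * \<mu>))\<^sup>2 = 1 - 4 * Re \<mu> + 4 * (cmod \<mu>)\<^sup>2"
      unfolding cmod_power2 by (simp add: power2_eq_square algebra_simps)
    then have "(cmod \<mu>)\<^sup>2 = Re \<mu>"
      using \<mu> by simp
    moreover have "cnj b * M k = 2 * \<mu> * of_real ((cmod (M k))\<^sup>2)"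
      using complex_norm_square[of "M k"] by (simp add: b_def mult_ac)
    then have "Re (cnj b * M k) = 2 * Re \<mu> * (cmod (M k))\<^sup>2" by simp
    ultimately show ?thesis
      unfolding b_def by (simp add: norm_mult power_mult_distrib add_divide_distrib)
  qed
  ultimately have I2: "((\<lambda>t. w t * ((2 + (cmod b)\<^sup>2) / 2) - Re (cnj b * (u t ^ k * of_real (w t))))
              has_integral 1) {0..1}" by simp
  have le: "cmod (u t ^ (j + k) * of_real (w t) - b * (u t ^ j * of_real (w t)))
      \<le> w t * ((2 + (cmod b)\<^sup>2) / 2) - Re (cnj b * (u t ^ k * of_real (w t)))" for t
  proof -
    have cu: "cmod (u t) = 1" by (simp add: u_def)
    define g where "g = u t ^ k - b"
    have "u t ^ (j + k) * of_real (w t) - b * (u t ^ j * of_real (w t)) = u t ^ j * g * of_real (w t)"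
      by (simp add: g_def algebra_simps power_add)
    then have "cmod (u t ^ (j + k) * of_real (w t) - b * (u t ^ j * of_real (w t))) = cmod g * w t"
      using w[of t] by (simp add: norm_mult norm_power cu)
    \<comment> \<open>From 2 |g| \<le> 1 + |g|^2: unlike the modulus, the square can be integrated
      exactly.\<close>
    also have "\<dots> \<le> (1 + (cmod g)\<^sup>2) / 2 * w t"
      using sum_squares_bound[of "cmod g" 1] w[of t] by (intro mult_right_mono) auto
    also have "(cmod g)\<^sup>2 = 1 + (cmod b)\<^sup>2 - 2 * Re (cnj b * u t ^ k)"
    proof -
      have "(cmod (u t ^ k))\<^sup>2 = 1" by (simp add: norm_power cu)
      then show ?thesis
        unfolding g_def cmod_power2 by (simp add: power2_eq_square algebra_simps)
    qed
    finally have "cmod (u t ^ (j + k) * of_real (w t) - b * (u t ^ j * of_real (w t)))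
        \<le> (1 + (1 + (cmod b)\<^sup>2 - 2 * Re (cnj b * u t ^ k))) / 2 * w t" .
    moreover have "Re (cnj b * (u t ^ k * of_real (w t))) = Re (cnj b * u t ^ k) * w t"
      by (simp flip: mult.assoc)
    moreover have "(1 + (1 + (cmod b)\<^sup>2 - 2 * x)) / 2 * w t = w t * ((2 + (cmod b)\<^sup>2) / 2) - x * w t" for x
      by (simp add: field_simps)
    ultimately show ?thesis by metis
  qed
  have eq: "M (j + k) - b * M j = cnj ((c (j + k) - \<mu> * c j * c k) * of_real r ^ (j + k)) / 2"
    by (simp add: M_def b_def power_add algebra_simps)
  have "cmod (M (j + k) - b * M j) \<le> 1"
    using Henstock_Kurzweil_Integration.integral_norm_bound_integral
        [OF has_integral_integrable[OF I1] has_integral_integrable[OF I2] le]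
    by (simp only: integral_unique[OF I1] integral_unique[OF I2])
  moreover have "cmod (M (j + k) - b * M j) = cmod (\<mu> * c j * c k - c (j + k)) * r ^ (j + k) / 2"
    using r unfolding eq norm_divide complex_mod_cnj by (simp add: norm_mult norm_power norm_minus_commute)
  ultimately show ?thesis by simp
qed

lemma caratheodory_unimodular_bound:
  fixes p :: "complex \<Rightarrow> complex"
  assumes p: "p holomorphic_on ball 0 1" and Re: "\<And>z. z \<in> ball 0 1 \<Longrightarrow> Re (p z) > 0"
    and p0: "p 0 = 1" and jk: "j > 0" "k > 0" and \<mu>: "cmod (1 - 2 * \<mu>) = 1"
  defines "c \<equiv> \<lambda>l. (deriv ^^ l) p 0 / fact l"
  shows "cmod (\<mu> * c j * c k - c (j + k)) \<le> 2"
\<comment> \<open>Only the factor \<open>r ^ (j + k)\<close> depends on r, so the limit needs no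
  boundary values of p.\<close>
proof (rule tendsto_upperbound)
  show "((\<lambda>r. cmod (\<mu> * c j * c k - c (j + k)) * r ^ (j + k)) \<longlongrightarrow> cmod (\<mu> * c j * c k - c (j + k))) (at_left 1)"
    by (auto intro!: tendsto_eq_intros)
  show "\<forall>\<^sub>F r in at_left 1. cmod (\<mu> * c j * c k - c (j + k)) * r ^ (j + k) \<le> 2"
    unfolding eventually_at_left_field c_def
    using caratheodory_disk_bound[OF p Re p0 jk _ _ \<mu>] by (intro exI[of _ 0]) auto
qed auto

section \<open>A sum of two moduli as a bound on a pencil\<close>

lemma ex_unimodular_norm_add:
  fixes A B :: complex
  obtains v where "cmod v = 1" "cmod (A - v * B) = cmod A + cmod B"
proof -
  \<comment> \<open>The rotation carries \<open>B\<close> to the direction of \<open>A\<close>; the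
    sign turns the subtraction into addition. If \<open>A\<close> or \<open>B\<close> is 0,
    \<open>v\<close> is still unimodular.\<close>
  define v where "v = - cis (Arg A - Arg B)"
  have A: "A = of_real (cmod A) * cis (Arg A)" and B: "B = of_real (cmod B) * cis (Arg B)"
    by (simp_all flip: rcis_def add: rcis_cmod_Arg)
  have "v * B = - of_real (cmod B) * cis (Arg A)"
    by (subst B) (simp add: v_def cis_mult algebra_simps)
  then have "A - v * B = of_real (cmod A + cmod B) * cis (Arg A)"
    by (subst A) (simp add: algebra_simps)
  then have "cmod (A - v * B) = cmod A + cmod B"
    by (simp add: norm_mult del: of_real_add)
  moreover have "cmod v = 1" by (simp add: v_def)
  ultimately show ?thesis using that by blast
qed

text \<open>This is the equivalence of the two inequalities in abstract form. One direction is the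
  triangle inequality; for the other a single aligned unimodular \<open>v\<close> suffices.\<close>

lemma norm_add_le_iff_pencil:
  fixes A B :: complex
  assumes "C \<ge> 0"
  shows "cmod A + cmod B \<le> C \<longleftrightarrow> (\<forall>v. cmod (A - v * B) \<le> C * max 1 (cmod v))"
proof
  assume le: "cmod A + cmod B \<le> C"
  show "\<forall>v. cmod (A - v * B) \<le> C * max 1 (cmod v)"
  proof
    fix v
    have "cmod (A - v * B) \<le> cmod A * 1 + cmod B * cmod v"
      using norm_triangle_ineq4[of A "v * B"] by (simp add: norm_mult mult_ac)
    also have "\<dots> \<le> cmod A * max 1 (cmod v) + cmod B * max 1 (cmod v)"
      by (intro add_mono mult_left_mono) auto
    also have "\<dots> \<le> C * max 1 (cmod v)"
      using le by (simp add: mult_right_mono flip: distrib_right)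
    finally show "cmod (A - v * B) \<le> C * max 1 (cmod v)" .
  qed
next
  assume "\<forall>v. cmod (A - v * B) \<le> C * max 1 (cmod v)"
  moreover obtain v where "cmod v = 1" "cmod (A - v * B) = cmod A + cmod B"
    by (rule ex_unimodular_norm_add)
  ultimately show "cmod A + cmod B \<le> C" by (metis max.idem mult.right_neutral)
qed

section \<open>Coefficients of the derivative and the extremal functions\<close>

lemma higher_deriv_deriv_eq_taylor_coeff:
  "(deriv ^^ k) (deriv f) 0 / fact k = of_nat (Suc k) * taylor_coeff f (Suc k)"
  by (simp add: taylor_coeff_def fps_expansion_def funpow_Suc_right del: funpow.simps of_nat_Suc)

text \<open>The real part is the Poisson kernel (1 - |w|^2) / |1 - w|^2.\<close>

lemma Re_one_plus_div_one_minus_pos: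
  assumes "cmod w < 1"
  shows "Re ((1 + w) / (1 - w)) > 0"
proof -
  have "w \<noteq> 1" using assms by auto
  then have "(cmod (1 - w))\<^sup>2 > 0" by simp
  moreover have "(cmod w)\<^sup>2 < 1"
    using assms by (simp add: power_less_one_iff)
  moreover have "Re ((1 + w) / (1 - w)) = (1 - (cmod w)\<^sup>2) / (cmod (1 - w))\<^sup>2"
    unfolding Re_divide cmod_power2 by (simp add: power2_eq_square algebra_simps)
  ultimately show ?thesis by simp
qed

lemma norm_power_less_one:
  assumes "d > 0" "z \<in> ball (0::complex) 1"
  shows "cmod (z ^ d) < 1"
  using assms by (simp add: norm_power power_less_one_iff)

lemma noshiro_warschawski_half_plane_primitive:
  assumes d: "d > 0" and g0: "g 0 = 0"
    and der: "\<And>z. z \<in> ball 0 1 \<Longrightarrow> (g has_field_derivative (1 + z ^ d) / (1 - z ^ d)) (at z)"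
  shows "g \<in> noshiro_warschawski"
proof -
  have deriv: "deriv g z = (1 + z ^ d) / (1 - z ^ d)" if "z \<in> ball 0 1" for z
    using der[OF that] by (rule DERIV_imp_deriv)
  have "g holomorphic_on ball 0 1"
    unfolding holomorphic_on_open[OF open_ball] using der by blast
  moreover have "Re (deriv g z) > 0" if "z \<in> ball 0 1" for z
    using Re_one_plus_div_one_minus_pos[OF norm_power_less_one[OF d that]] deriv[OF that] by simp
  ultimately show ?thesis
    using g0 deriv[of 0] d by (simp add: noshiro_warschawski_def zero_power)
qed

text \<open>Comparing coefficients in g'(z) (1 - z^d) = 1 + z^d gives a recursion of step d, whose
  solution is 1 + 2 z^d + 2 z^(2d) + ...\<close>

lemma taylor_coeff_half_plane_primitive:
  assumes d: "d > 0"
    and der: "\<And>z. z \<in> ball 0 1 \<Longrightarrow> (g has_field_derivative (1 + z ^ d) / (1 - z ^ d)) (at z)"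
  shows "of_nat (Suc k) * taylor_coeff g (Suc k) = (if k = 0 then 1 else if d dvd k then 2 else 0)"
proof -
  define P where "P = fps_expansion (deriv g) 0"
  have "g holomorphic_on ball 0 1"
    unfolding holomorphic_on_open[OF open_ball] using der by blast
  then have "deriv g holomorphic_on ball 0 1"
    by (intro holomorphic_deriv) auto
  then have "deriv g has_fps_expansion P"
    unfolding P_def by (intro has_fps_expansion_fps_expansion[of "ball 0 1"]) auto
  then have exp: "(\<lambda>z. deriv g z * (1 - z ^ d)) has_fps_expansion P * (1 - fps_X ^ d)"
    by (intro fps_expansion_intros)
  have ev: "\<forall>\<^sub>F z in nhds 0. deriv g z * (1 - z ^ d) = 1 + z ^ d"
  proof (rule eventually_nhds_in_open[of "ball 0 1", THEN eventually_mono])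
    fix z :: complex assume z: "z \<in> ball 0 1"
    have "z ^ d \<noteq> 1" using norm_power_less_one[OF d z] by auto
    then show "deriv g z * (1 - z ^ d) = 1 + z ^ d"
      using DERIV_imp_deriv[OF der[OF z]] by simp
  qed auto
  have exp': "(\<lambda>z::complex. 1 + z ^ d) has_fps_expansion 1 + fps_X ^ d"
    by (intro fps_expansion_intros)
  have eq: "P * (1 - fps_X ^ d) = 1 + fps_X ^ d"
    by (rule fps_expansion_unique_complex[OF has_fps_expansion_cong[OF ev refl, THEN iffD1, OF exp] exp'])
  have rec: "fps_nth P k - (if k < d then 0 else fps_nth P (k - d))
      = (if k = 0 then 1 else 0) + (if k = d then 1 else 0)" for k
    using arg_cong[OF eq, of "\<lambda>F. fps_nth F k"]
    by (simp add: right_diff_distrib fps_X_power_mult_right_nth)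
  have "fps_nth P k = (if k = 0 then 1 else if d dvd k then 2 else 0)"
  \<comment> \<open>The value 2 arises at k = d, as the constant term 1 plus the coefficient 1 of
    z^d; beyond d the recursion only copies values.\<close>
  proof (induction k rule: less_induct)
    case (less k)
    consider "k < d" | "k = d" | "k > d" by linarith
    then show ?case
    proof cases
      case 1
      then show ?thesis using rec[of k] by (auto dest: dvd_imp_le)
    next
      case 2
      then show ?thesis using rec[of k] less.IH[of 0] d by auto
    next
      case 3
      then show ?thesis using rec[of k] less.IH[of "k - d"] d by (simp add: dvd_minus_self)
    qed
  qed
  then show ?thesis
    unfolding higher_deriv_deriv_eq_taylor_coeff[symmetric] P_def fps_expansion_def by simp
qed

text \<open>The exponent 1 is kept so that the general results apply with d = 1.\<close>

lemma log_extremal_has_field_derivative: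
  assumes "z \<in> ball 0 1"
  shows "(log_extremal has_field_derivative (1 + z ^ 1) / (1 - z ^ 1)) (at z)"
proof -
  have z: "z \<noteq> 1" and "Re z < 1"
    using assms complex_Re_le_cmod[of z] by auto
  \<comment> \<open>Keeps the argument of \<open>Ln\<close> off its branch cut.\<close>
  then have "Re (1 / (1 - z)) > 0"
    by (simp add: Re_divide)
       (metis Re_complex_of_real add_pos_nonneg diff_gt_0_iff_gt divide_pos_pos zero_le_power2 zero_less_power)
  then have "1 / (1 - z) \<notin> \<real>\<^sub>\<le>\<^sub>0"
    by (auto simp: complex_nonpos_Reals_iff)
  then have "(log_extremal has_field_derivative 2 * (1 / (1 - z)\<^sup>2 / (1 / (1 - z))) - 1) (at z)"
    unfolding log_extremal_def [abs_def] using z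
    by (auto intro!: derivative_eq_intros simp: power2_eq_square)
  moreover have "2 * (1 / w\<^sup>2 / (1 / w)) - 1 = (2 - w) / w" if "w \<noteq> 0" for w :: complex
    using that by (simp add: power2_eq_square field_simps)
  from this[of "1 - z"] have "2 * (1 / (1 - z)\<^sup>2 / (1 / (1 - z))) - 1 = (1 + z ^ 1) / (1 - z ^ 1)"
    using z by simp
  ultimately show ?thesis by (simp only:)
qed

lemma integral_extremal_has_field_derivative:
  assumes d: "m + n > 2" and z: "z \<in> ball 0 1"
  shows "(integral_extremal m n has_field_derivative
           (1 + z ^ (m + n - 2)) / (1 - z ^ (m + n - 2))) (at z)"
proof -
  define F :: "complex \<Rightarrow> complex" where "F z = (1 + z ^ (m + n - 2)) / (1 - z ^ (m + n - 2))" for z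
  have "z ^ (m + n - 2) \<noteq> 1" if "z \<in> ball 0 1" for z :: complex
    using norm_power_less_one[OF _ that, of "m + n - 2"] d by auto
  then have "F holomorphic_on ball 0 1"
    unfolding F_def by (auto intro!: holomorphic_intros)
  then obtain G where G: "(G has_field_derivative F x) (at x within ball 0 1)"
      if "x \<in> ball 0 1" for x
    using holomorphic_convex_primitive'[of "ball 0 1" F] by auto
  \<comment> \<open>The disk is convex, so the segment stays inside it and the integral is a
    difference of values of the primitive.\<close>
  have eq: "G x - G 0 = integral_extremal m n x" if "x \<in> ball 0 1" for x
  proof -
    have "path_image (linepath 0 x) \<subseteq> ball 0 1"
      using that by (simp add: closed_segment_subset)
    from contour_integral_primitive[OF G valid_path_linepath this]
    show ?thesis
      by (simp add: integral_extremal_def F_def [abs_def] contour_integral_unique)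
  qed
  have "((\<lambda>x. G x - G 0) has_field_derivative F z) (at z)"
    using DERIV_diff[OF G[OF z] DERIV_const[of "G 0"]] by (simp add: at_within_open[OF z open_ball])
  then have "(integral_extremal m n has_field_derivative F z) (at z)"
    using open_ball z eq by (rule has_field_derivative_transform_within_open)
  then show ?thesis by (simp add: F_def)
qed

section \<open>The coefficient functionals as a pencil\<close>

lemma zalcman_functional_pencil:
  fixes a :: "nat \<Rightarrow> complex"
  assumes "m > 0" "n > 0"
  defines "N \<equiv> m + n - 1"
  defines "B \<equiv> of_nat (m * n) / (2 * of_nat N) * a m * a n"
  shows "zalcman_functional \<mu> m n a =
      cmod (B - a N - (1 - 2 * \<mu> * (of_nat N / of_nat (m * n))) * B)"
proof -
  have "N > 0" using assms(1,2) by (simp add: N_def)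
  then have "B - a N - (1 - 2 * \<mu> * (of_nat N / of_nat (m * n))) * B = \<mu> * a m * a n - a N"
    using assms(1,2) by (simp add: B_def field_simps)
  then show ?thesis
    by (simp only: zalcman_functional_def N_def [symmetric])
qed

lemma coeff_sum_eq_norm_add:
  defines "B \<equiv> \<lambda>m n a. of_nat (m * n) / (2 * of_nat (m + n - 1)) * a m * a n"
  shows "coeff_sum m n a = cmod (B m n a - a (m + n - 1)) + cmod (B m n a)"
  by (simp add: coeff_sum_def B_def norm_mult norm_divide)

lemma coeff_sum_le_iff_zalcman:
  assumes mn: "m > 0" "n > 0" and C: "C \<ge> 0"
  shows "coeff_sum m n a \<le> C \<longleftrightarrow>
    (\<forall>\<mu>. zalcman_functional \<mu> m n a \<le> C * max 1 (param_modulus \<mu> m n))"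
proof -
  define N where "N = m + n - 1"
  define B where "B = of_nat (m * n) / (2 * of_nat N) * a m * a n"
  have "of_nat N \<noteq> (0::complex)"
    using mn by (simp add: N_def del: of_nat_diff)
  \<comment> \<open>As \<mu> runs over the complex numbers, so does \<open>v\<close>; hence the two
    universal quantifiers agree.\<close>
  then have surj: "\<exists>\<mu>. v = 1 - 2 * \<mu> * (of_nat N / of_nat (m * n))" for v :: complex
    using mn by (intro exI[of _ "(1 - v) * of_nat (m * n) / (2 * of_nat N)"]) (simp add: field_simps)
  have "coeff_sum m n a \<le> C \<longleftrightarrow> (\<forall>v. cmod (B - a N - v * B) \<le> C * max 1 (cmod v))"
    unfolding coeff_sum_eq_norm_add norm_add_le_iff_pencil[OF C] B_def N_def ..
  also have "\<dots> \<longleftrightarrow> (\<forall>\<mu>. zalcman_functional \<mu> m n a \<le> C * max 1 (param_modulus \<mu> m n))"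
    unfolding zalcman_functional_pencil[OF mn] param_modulus_def B_def [symmetric] N_def [symmetric]
    using surj by metis
  finally show ?thesis .
qed

lemma coeff_sum_noshiro_warschawski:
  assumes f: "f \<in> noshiro_warschawski" and mn: "m \<ge> 2" "n \<ge> 2"
  shows "coeff_sum m n (taylor_coeff f) \<le> 2 / real (m + n - 1)"
proof -
  define N where "N = m + n - 1"
  define a where "a = taylor_coeff f"
  define B where "B = of_nat (m * n) / (2 * of_nat N) * a m * a n"
  define c where "c l = (deriv ^^ l) (deriv f) 0 / fact l" for l
  have N: "N > 0" "(m - 1) + (n - 1) = N - 1" using mn by (auto simp: N_def)
  have c: "c (l - 1) = of_nat l * a l" if "l > 0" for l
    using higher_deriv_deriv_eq_taylor_coeff[of "l - 1" f] that by (simp add: c_def a_def)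
  obtain v where v: "cmod v = 1" "cmod (B - a N - v * B) = cmod (B - a N) + cmod B"
    by (rule ex_unimodular_norm_add)
  \<comment> \<open>This parameter belongs to the coefficients of f'. Since
    \<open>c (m - 1) * c (n - 1)\<close> equals 2 N B, the expression bounded by 2 becomes N ((1 -
    v) B - a_N).\<close>
  define \<mu> where "\<mu> = (1 - v) / 2"
  have "1 - 2 * \<mu> = v" by (simp add: \<mu>_def field_simps)
  then have \<mu>: "cmod (1 - 2 * \<mu>) = 1" using v(1) by simp
  have "deriv f holomorphic_on ball 0 1"
    using f by (auto simp: noshiro_warschawski_def intro: holomorphic_deriv)
  then have "cmod (\<mu> * c (m - 1) * c (n - 1) - c ((m - 1) + (n - 1))) \<le> 2"
    unfolding c_def using f mn \<mu>
    by (intro caratheodory_unimodular_bound) (auto simp: noshiro_warschawski_def)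
  also have "\<mu> * c (m - 1) * c (n - 1) - c ((m - 1) + (n - 1)) = of_nat N * (B - a N - v * B)"
  proof -
    have cs: "c (m - 1) = of_nat m * a m" "c (n - 1) = of_nat n * a n" "c (N - 1) = of_nat N * a N"
      using mn N(1) by (simp_all only: c)
    show ?thesis
      unfolding N(2) cs using N(1) by (simp add: B_def \<mu>_def field_simps)
  qed
  finally have "N * (cmod (B - a N) + cmod B) \<le> 2"
    by (simp add: norm_mult v(2))
  then show ?thesis
    using N(1) by (simp add: coeff_sum_eq_norm_add a_def N_def B_def field_simps)
qed

theorem theorem4:
  fixes f :: "complex \<Rightarrow> complex" and m n :: nat
  assumes "f \<in> noshiro_warschawski" and "m \<ge> 2" and "n \<ge> 2"
  shows
    "coeff_sum m n (taylor_coeff f) \<le> 2 / real (m + n - 1)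
     \<and> (\<forall>\<mu>. zalcman_functional \<mu> m n (taylor_coeff f)
              \<le> 2 / real (m + n - 1) * max 1 (param_modulus \<mu> m n))
     \<and> (\<forall>a :: nat \<Rightarrow> complex.
          coeff_sum m n a \<le> 2 / real (m + n - 1) \<longleftrightarrow>
          (\<forall>\<mu>. zalcman_functional \<mu> m n a
                 \<le> 2 / real (m + n - 1) * max 1 (param_modulus \<mu> m n)))
     \<and> log_extremal \<in> noshiro_warschawski
     \<and> coeff_sum m n (taylor_coeff log_extremal) = 2 / real (m + n - 1)
     \<and> (\<forall>\<mu>. param_modulus \<mu> m n \<ge> 1 \<longrightarrow>
          zalcman_functional \<mu> m n (taylor_coeff log_extremal)
            = 2 / real (m + n - 1) * max 1 (param_modulus \<mu> m n))
     \<and> integral_extremal m n \<in> noshiro_warschawski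
     \<and> coeff_sum m n (taylor_coeff (integral_extremal m n)) = 2 / real (m + n - 1)
     \<and> (\<forall>\<mu>. param_modulus \<mu> m n < 1 \<longrightarrow>
          zalcman_functional \<mu> m n (taylor_coeff (integral_extremal m n))
            = 2 / real (m + n - 1) * max 1 (param_modulus \<mu> m n))"
proof -
  define N where "N = m + n - 1"
  have N: "N > 0" "Suc (m + n - 2) = N" "N \<ge> 2"
    using assms by (auto simp: N_def)
  have iff: "coeff_sum m n a \<le> 2 / real N \<longleftrightarrow>
      (\<forall>\<mu>. zalcman_functional \<mu> m n a \<le> 2 / real N * max 1 (param_modulus \<mu> m n))" for a
    using assms by (intro coeff_sum_le_iff_zalcman) auto
  have bound: "coeff_sum m n (taylor_coeff f) \<le> 2 / real N"
    unfolding N_def using assms by (intro coeff_sum_noshiro_warschawski)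
  have log: "log_extremal \<in> noshiro_warschawski"
    by (rule noshiro_warschawski_half_plane_primitive[OF _ _ log_extremal_has_field_derivative])
       (auto simp: log_extremal_def)
  have log_coeff: "taylor_coeff log_extremal l = 2 / of_nat l" if "l \<ge> 2" for l
    using taylor_coeff_half_plane_primitive[OF _ log_extremal_has_field_derivative, of "l - 1"] that
    by (simp add: field_simps)
  have log_sum: "coeff_sum m n (taylor_coeff log_extremal) = 2 / real N"
  proof -
    \<comment> \<open>For the logarithm B = a_N: the first term of the sum vanishes and the second
      attains the bound alone.\<close>
    have "of_nat (m * n) / (2 * of_nat N) * (2 / of_nat m) * (2 / of_nat n) - 2 / of_nat N = (0::complex)"
      using assms by (simp add: divide_simps)
    moreover have "real (m * n) * cmod (2 / of_nat m * (2 / of_nat n)) / (2 * real N) = 2 / real N"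
      using assms by (simp add: norm_mult norm_divide)
    ultimately show ?thesis
      using assms N(3) by (simp only: coeff_sum_def log_coeff N_def [symmetric]) simp
  qed
  have log_zalcman: "zalcman_functional \<mu> m n (taylor_coeff log_extremal)
      = 2 / real N * param_modulus \<mu> m n" for \<mu>
  proof -
    have "\<mu> * (2 / of_nat m) * (2 / of_nat n) - 2 / of_nat N
        = - (2 / of_nat N * (1 - 2 * \<mu> * (of_nat N / of_nat (m * n))))"
      using assms N(1) by (simp add: field_simps)
    then show ?thesis
      using assms N(3)
      by (simp only: zalcman_functional_def param_modulus_def log_coeff N_def [symmetric] norm_minus_cancel norm_mult)
         (simp add: norm_divide)
  qed
  have int: "integral_extremal m n \<in> noshiro_warschawski"
    by (rule noshiro_warschawski_half_plane_primitive[OF _ _ integral_extremal_has_field_derivative])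
       (use assms in \<open>auto simp: integral_extremal_def\<close>)
  have int_coeff: "of_nat (Suc k) * taylor_coeff (integral_extremal m n) (Suc k)
      = (if k = 0 then 1 else if m + n - 2 dvd k then 2 else 0)" for k
    by (rule taylor_coeff_half_plane_primitive[OF _ integral_extremal_has_field_derivative])
       (use assms in auto)
  \<comment> \<open>Since 0 < m - 1 < m + n - 2, the coefficient a_m vanishes, and both functionals
    reduce to |a_N| = 2 / N.\<close>
  have "\<not> m + n - 2 dvd m - 1"
    using assms by (intro nat_dvd_not_less) auto
  then have int_m: "taylor_coeff (integral_extremal m n) m = 0"
    using int_coeff[of "m - 1"] assms by simp
  have int_N: "taylor_coeff (integral_extremal m n) N = 2 / of_nat N"
    using int_coeff[of "m + n - 2"] assms N(1) unfolding N(2) by (simp add: field_simps)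
  have int_sum: "coeff_sum m n (taylor_coeff (integral_extremal m n)) = 2 / real N"
    by (simp only: coeff_sum_def int_m int_N N_def [symmetric]) (simp add: norm_divide)
  have int_zalcman: "zalcman_functional \<mu> m n (taylor_coeff (integral_extremal m n)) = 2 / real N" for \<mu>
    by (simp only: zalcman_functional_def int_m int_N N_def [symmetric]) (simp add: norm_divide)
  \<comment> \<open>Both evaluations hold for every \<mu>; the case condition only decides which
    entry of the maximum survives.\<close>
  show ?thesis
    unfolding N_def [symmetric] log_zalcman int_zalcman
    using iff bound log log_sum int int_sum by (auto simp: max_def)
qed

end
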